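(* Let $0<\epsilon<\frac12$. For real $x\ge 1$ put $N=N(x):=\lfloor x^{\frac12+\epsilon}\rfloor$, let $G(u):=\frac1u\sin\left(\frac1u\right)$ for $u>0$, and define $\mathcal{E}_N(x)$ by the equation $$Q(x)=\sum_{n=1}^{N-1}\frac1n\sin\left(\frac xn\right)+\frac1{2N}\sin\left(\frac xN\right)+\mathrm{Si}\left(\frac xN\right)+\mathcal{E}_N(x).$$ Then for every integer $M\ge 0$, $$\mathcal{E}_N(x)=-\sum_{m=1}^{M}\frac{B_{2m}}{(2m)!}\,\frac{G^{(2m-1)}\left(\frac Nx\right)}{x^{2m}}+O_{M,\epsilon}\left(x^{-\frac12-(4M+3)\epsilon}\right),$$ that is, there is a constant $C>0$ depending only on $M$ and $\epsilon$ such that for all $x\ge 1$ the absolute value of the difference between $\mathcal{E}_N(x)$ and the finite sum $-\sum_{m=1}^{M}\frac{B_{2m}}{(2m)!}\frac{G^{(2m-1)}(N/x)}{x^{2m}}$ is at most $C\,x^{-\frac12-(4M+3)\epsilon}$ (for $M=0$ the sum is empty).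
   Context: The Hardy-Littlewood function is $Q(x):=\sum_{n\ge1}\frac1n\sin\left(\frac xn\right)$. The sine integral is $\mathrm{Si}(x):=\int_0^x\frac{\sin t}{t}\,dt$. $B_n$ denotes the $n$-th Bernoulli number ($B_2=\frac16$, $B_4=-\frac1{30}$, ...). $G^{(k)}$ denotes the $k$-th derivative of $G$, and $\lfloor y\rfloor$ is the integer part of $y$. An empty sum equals $0$. *)

theory Defs
  imports "HOL-Probability.Sinc_Integral"
begin

definition hardy_littlewood_Q :: "real \<Rightarrow> real" where
  "hardy_littlewood_Q x = (\<Sum>n. 1 / real (Suc n) * sin (x / real (Suc n)))"

lemma summable_hardy_littlewood_Q:
  "summable (\<lambda>n. 1 / real (Suc n) * sin (x / real (Suc n)))"
proof (rule summable_comparison_test')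
  have "summable (\<lambda>n. 1 / real n ^ 2)"
    using inverse_power_summable[of 2, where 'a = real] by (simp add: field_simps)
  then have "summable (\<lambda>n. 1 / real (Suc n) ^ 2)"
    by (subst summable_Suc_iff)
  then show "summable (\<lambda>n. \<bar>x\<bar> * (1 / real (Suc n) ^ 2))"
    by (rule summable_mult)
next
  fix n :: nat
  have "\<bar>1 / real (Suc n) * sin (x / real (Suc n))\<bar> \<le> 1 / real (Suc n) * \<bar>x / real (Suc n)\<bar>"
    unfolding abs_mult by (intro mult_mono abs_sin_x_le_abs_x) auto
  also have "\<dots> = \<bar>x\<bar> * (1 / real (Suc n) ^ 2)"
    by (simp add: power2_eq_square)
  finally show "norm (1 / real (Suc n) * sin (x / real (Suc n))) \<le> \<bar>x\<bar> * (1 / real (Suc n) ^ 2)"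
    by simp
qed

text \<open>
  Bernoulli numbers by the standard recurrence, which is
  \<open>(\<Sum>k\<le>n. (n + 1 choose k) * B k) = 0\<close> for \<open>n > 0\<close> solved for \<open>B n\<close>; here \<open>B 1 = -1/2\<close>.
\<close>
fun bernoulli :: "nat \<Rightarrow> real" where
  "bernoulli n =
     (if n = 0 then 1
      else - (\<Sum>k<n. real (Suc n choose k) * bernoulli k) / real (Suc n))"

declare bernoulli.simps [simp del]

lemma bernoulli_2_4: "bernoulli 2 = 1 / 6" "bernoulli 4 = - 1 / 30"
proof -
  have b0: "bernoulli 0 = 1" by (simp add: bernoulli.simps)
  have b1: "bernoulli (Suc 0) = - 1 / 2" by (subst bernoulli.simps) (simp add: b0)
  have b2: "bernoulli (Suc (Suc 0)) = 1 / 6"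
    by (subst bernoulli.simps) (simp add: b0 b1)
  have b3: "bernoulli (Suc (Suc (Suc 0))) = 0"
    by (subst bernoulli.simps) (simp add: b0 b1 b2)
  have b4: "bernoulli (Suc (Suc (Suc (Suc 0)))) = - 1 / 30"
    by (subst bernoulli.simps) (simp add: b0 b1 b2 b3)
  from b2 b4 show "bernoulli 2 = 1 / 6" "bernoulli 4 = - 1 / 30"
    by (simp_all add: eval_nat_numeral)
qed

definition cutoff :: "real \<Rightarrow> real \<Rightarrow> nat" where
  "cutoff \<epsilon> x = nat \<lfloor>x powr (1 / 2 + \<epsilon>)\<rfloor>"

text \<open>Only the values of \<open>G\<close> at \<open>u > 0\<close> are meaningful.\<close>
definition G :: "real \<Rightarrow> real" where
  "G u = 1 / u * sin (1 / u)"

definition Q_error :: "nat \<Rightarrow> real \<Rightarrow> real" where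
  "Q_error N x = hardy_littlewood_Q x -
     ((\<Sum>n = 1..N - 1. 1 / real n * sin (x / real n))
      + 1 / (2 * real N) * sin (x / real N)
      + Si (x / real N))"

end

theory Submission
  imports Defs "HOL-Computational_Algebra.Formal_Power_Series"
begin

text \<open>
  Put \<open>f t = sin (x / t) / t\<close>, with antiderivative \<open>F t = - Si (x / t)\<close> vanishing at infinity, and let
  \<open>T = F + (\<Sum>k=1..K. B k / k! * f^(k-1))\<close>. Taylor expansion of \<open>T (n + 1)\<close> around \<open>n\<close> and the
  recurrence of the Bernoulli numbers give \<open>T (n + 1) - T n = f n\<close> up to \<open>O (sup f^(K))\<close> on
  \<open>[n, n + 1]\<close>, with no need for Bernoulli polynomials; summing over \<open>n \<ge> N\<close> evaluates the tail
  of \<open>Q\<close> as \<open>- T N\<close>. Since \<open>f t = G (t / x) / x\<close> and, for \<open>k \<ge> 1\<close>, \<open>G^(k) u\<close> is \<open>(1 / u)^2\<close> times a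
  combination of \<open>sin (1 / u)\<close> and \<open>cos (1 / u)\<close> with coefficients of degree at most \<open>2 k - 1\<close> in \<open>1 / u\<close>, the \<open>m\<close>-th correction term at
  \<open>u = N / x\<close> has order \<open>x powr (- 1 / 2 - (4 m - 1) \<epsilon>)\<close>, and the remainder becomes smaller than any
  given power of \<open>x\<close> as \<open>K\<close> grows. So one expands far beyond \<open>M\<close> and discards the terms \<open>m > M\<close>.
\<close>

section \<open>Bernoulli numbers: recurrence, generating function and odd indices\<close>

lemma bernoulli_0 [simp]: "bernoulli 0 = 1"
  by (simp add: bernoulli.simps)

text \<open>For \<open>r = n + 1\<close> with \<open>n > 0\<close> this is the defining recurrence
  at \<open>n\<close>, divided by \<open>fact r\<close>. Since \<open>k = r\<close> is left out, the
  sum is the coefficient of z^r in the product of the exponential generating function with e^z -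
  1.\<close>

lemma bernoulli_convolution:
  "(\<Sum>k<r. bernoulli k / (fact k * fact (r - k))) = (if r = 1 then 1 else 0)"
proof -
  consider "r = 0" | "r = 1" | n where "r = Suc n" "n > 0"
    by (metis One_nat_def gr0_conv_Suc neq0_conv not0_implies_Suc)
  then show ?thesis
  proof cases
    case 3
    have "bernoulli n = - (\<Sum>k<n. real (Suc n choose k) * bernoulli k) / real (Suc n)"
      using \<open>n > 0\<close> by (subst bernoulli.simps) simp
    then have rec: "(\<Sum>k<Suc n. real (Suc n choose k) * bernoulli k) = 0"
      by (simp add: field_simps del: of_nat_Suc binomial_Suc_Suc)
    have "(\<Sum>k<r. bernoulli k / (fact k * fact (r - k)))
        = (\<Sum>k<Suc n. real (Suc n choose k) * bernoulli k / fact (Suc n))"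
      unfolding \<open>r = Suc n\<close> by (intro sum.cong refl) (simp add: binomial_fact field_simps del: fact_Suc binomial_Suc_Suc)
    also have "\<dots> = 0"
      using rec by (simp only: sum_divide_distrib [symmetric] div_0)
    finally show ?thesis
      using 3 by simp
  qed simp_all
qed

text \<open>The classical generating function z / (e^z - 1), in product form because e^z - 1 has
  zero constant term and so is no unit among power series.\<close>

lemma bernoulli_fps: "Abs_fps (\<lambda>n. bernoulli n / fact n) * (fps_exp 1 - 1) = fps_X"
proof (rule fps_ext)
  fix n
  have "fps_nth (Abs_fps (\<lambda>n. bernoulli n / fact n) * (fps_exp 1 - 1)) n
      = (\<Sum>i=0..n. bernoulli i / fact i * (if i = n then 0 else 1 / fact (n - i)))"
    unfolding fps_mult_nth by (intro sum.cong) auto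
  also have "\<dots> = (\<Sum>i<n. bernoulli i / (fact i * fact (n - i)))"
    by (rule sum.mono_neutral_cong_right) auto
  finally show "fps_nth (Abs_fps (\<lambda>n. bernoulli n / fact n) * (fps_exp 1 - 1)) n = fps_nth fps_X n"
    by (simp add: bernoulli_convolution)
qed

text \<open>The generating function satisfies b(-z) = b(z) + z. At an odd index other than 1 this
  says that the coefficient equals its own negative.\<close>

lemma bernoulli_odd_eq_0:
  assumes "odd n" "n \<noteq> 1"
  shows "bernoulli n = 0"
proof -
  define b where "b = Abs_fps (\<lambda>n. bernoulli n / fact n)"
  define b' where "b' = b oo (- fps_X)"
  have E: "fps_exp 1 oo (- fps_X) = fps_exp (- 1 :: real)"
    by (rule fps_ext) (simp add: fps_compose_uminus' fps_exp_def)
  have "(b * (fps_exp 1 - 1)) oo (- fps_X) = fps_X oo (- fps_X)"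
    unfolding b_def bernoulli_fps ..
  then have 1: "b' * (fps_exp (-1) - 1) = - fps_X"
    by (simp add: fps_compose_mult_distrib fps_compose_sub_distrib E b'_def)
  \<comment> \<open>Multiplication by e^z turns e^(-z) - 1 into 1 - e^z, so b(-z) and b(z) can be
    compared through the same factor e^z - 1, which is then cancelled.\<close>
  have "fps_exp 1 * fps_exp (-1) = (1 :: real fps)"
    by (simp flip: fps_exp_add_mult)
  then have "b' * (1 - fps_exp 1) = fps_exp 1 * (b' * (fps_exp (-1) - 1))"
    by (simp add: algebra_simps)
  then have "b' * (1 - fps_exp 1) = - (fps_exp 1 * fps_X)"
    unfolding 1 by simp
  then have "(b' - b - fps_X) * (fps_exp 1 - 1) = 0"
    using bernoulli_fps unfolding b_def [symmetric] by (simp add: algebra_simps)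
  moreover have "fps_exp 1 - 1 \<noteq> (0 :: real fps)"
    using fps_nonzeroI [of "fps_exp 1 - 1" 1] by simp
  ultimately have "b' - b - fps_X = 0"
    using mult_eq_0_iff by blast
  then have "b' = b + fps_X"
    by (simp add: algebra_simps)
  then have "fps_nth b' n = fps_nth b n"
    using assms by simp
  then show ?thesis
    using assms by (simp add: b'_def b_def fps_compose_uminus')
qed

text \<open>Brings the full Bernoulli sum into the usual even-index form of the Euler-Maclaurin
  formula; index 1 is the only odd one that contributes, and it yields the half-weight endpoint
  term.\<close>

lemma sum_bernoulli_even:
  assumes "L > 0"
  shows "(\<Sum>k\<le>2 * L. bernoulli k * c k) = c 0 - c 1 / 2 + (\<Sum>m=1..L. bernoulli (2 * m) * c (2 * m))"
  using assms
proof (induction L rule: nat_induct_non_zero)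
  case 1
  have "bernoulli (Suc 0) = - 1 / 2"
    by (subst bernoulli.simps) simp
  then show ?case
    by (simp add: numeral_2_eq_2)
next
  case (Suc L)
  then show ?case
    using bernoulli_odd_eq_0 [of "Suc (2 * L)"] by simp
qed

section \<open>Euler-Maclaurin summation on one unit interval and over an infinite tail\<close>

text \<open>Here \<open>D 0\<close> is the antiderivative, \<open>D 1\<close> the summand and
  \<open>D k\<close> the later derivatives. Once each \<open>D k (a + 1)\<close> is expanded at
  \<open>a\<close>, the coefficient of \<open>D r a\<close> in the difference is the sum of
  \<open>bernoulli_convolution\<close>, so only \<open>D 1 a\<close> survives.\<close>

lemma euler_maclaurin_step:
  fixes D :: "nat \<Rightarrow> real \<Rightarrow> real"
  assumes deriv: "\<And>k t. k \<le> K \<Longrightarrow> a \<le> t \<Longrightarrow> t \<le> a + 1 \<Longrightarrow> (D k has_real_derivative D (Suc k) t) (at t)"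
    and bound: "\<And>t. a \<le> t \<Longrightarrow> t \<le> a + 1 \<Longrightarrow> \<bar>D (Suc K) t\<bar> \<le> B"
    and "K \<ge> 1"
  shows "\<bar>(\<Sum>k\<le>K. bernoulli k * (D k (a + 1) / fact k)) - (\<Sum>k\<le>K. bernoulli k * (D k a / fact k)) - D 1 a\<bar>
    \<le> (\<Sum>k\<le>K. \<bar>bernoulli k\<bar>) * B"
proof -
  \<comment> \<open>The expansion of \<open>D k\<close> stops at \<open>j = K - k\<close>, so that
    every Lagrange remainder involves the same derivative \<open>D (Suc K)\<close> and one bound
    \<open>B\<close> serves them all.\<close>
  define R where "R k = D k (a + 1) - (\<Sum>j\<le>K - k. D (k + j) a / fact j)" for k
  have R: "\<bar>R k\<bar> \<le> B" if "k \<le> K" for k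
  proof -
    have "\<exists>t. a < t \<and> t < a + 1 \<and> D k (a + 1) =
        (\<Sum>m<Suc (K - k). D (k + m) a / fact m * (a + 1 - a) ^ m)
          + D (k + Suc (K - k)) t / fact (Suc (K - k)) * (a + 1 - a) ^ Suc (K - k)"
      by (rule Taylor_up [where diff = "\<lambda>m. D (k + m)" and a = a]) (use that deriv in auto)
    moreover have "Suc (k + (K - k)) = Suc K"
      using that by simp
    ultimately obtain t where t: "a < t" "t < a + 1"
      "R k = D (Suc K) t / fact (Suc (K - k))"
      by (auto simp: R_def lessThan_Suc_atMost simp del: fact_Suc)
    have "\<bar>R k\<bar> = \<bar>D (Suc K) t\<bar> / fact (Suc (K - k))"
      unfolding t by simp
    also have "\<dots> \<le> \<bar>D (Suc K) t\<bar> / 1"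
      by (intro divide_left_mono fact_ge_1) auto
    also have "\<dots> \<le> B"
      using bound [of t] t by simp
    finally show ?thesis .
  qed
  have "(\<Sum>k\<le>K. bernoulli k * (D k (a + 1) / fact k)) - (\<Sum>k\<le>K. bernoulli k * (D k a / fact k))
      = (\<Sum>k\<le>K. bernoulli k / fact k * R k)
        + (\<Sum>k\<le>K. bernoulli k / fact k * ((\<Sum>j\<le>K - k. D (k + j) a / fact j) - D k a))"
    unfolding sum.distrib [symmetric] sum_subtractf [symmetric]
    by (intro sum.cong) (auto simp: R_def algebra_simps)
  \<comment> \<open>Subtracting \<open>D k a\<close> cancels the term \<open>j = 0\<close>; hence
    \<open>r = k + j\<close> exceeds \<open>k\<close> strictly, as the convolution requires.\<close>
  also have "(\<Sum>k\<le>K. bernoulli k / fact k * ((\<Sum>j\<le>K - k. D (k + j) a / fact j) - D k a))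
      = (\<Sum>k\<le>K. \<Sum>r\<in>{k<..K}. D r a * (bernoulli k / (fact k * fact (r - k))))"
  proof (intro sum.cong refl)
    fix k assume "k \<in> {..K}"
    then have "k \<le> K" by simp
    have "(\<Sum>j\<le>K - k. D (k + j) a / fact j) = (\<Sum>r\<in>{k..K}. D r a / fact (r - k))"
      by (rule sum.reindex_bij_witness [of _ "\<lambda>r. r - k" "\<lambda>j. k + j"]) (use \<open>k \<le> K\<close> in auto)
    also have "\<dots> = D k a + (\<Sum>r\<in>{k<..K}. D r a / fact (r - k))"
      using \<open>k \<le> K\<close> by (subst sum.head) auto
    finally show "bernoulli k / fact k * ((\<Sum>j\<le>K - k. D (k + j) a / fact j) - D k a)
        = (\<Sum>r\<in>{k<..K}. D r a * (bernoulli k / (fact k * fact (r - k))))"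
      by (simp add: sum_distrib_left field_simps)
  qed
  \<comment> \<open>Exchange of summation over the triangle \<open>k < r \<le> K\<close>.\<close>
  also have "\<dots> = (\<Sum>r\<le>K. \<Sum>k<r. D r a * (bernoulli k / (fact k * fact (r - k))))"
    unfolding sum.Sigma [OF finite_atMost ballI [OF finite_greaterThanAtMost]]
      sum.Sigma [OF finite_atMost ballI [OF finite_lessThan]]
    by (rule sum.reindex_bij_witness [of _ "\<lambda>(r, k). (k, r)" "\<lambda>(k, r). (r, k)"]) auto
  also have "\<dots> = (\<Sum>r\<le>K. if r = 1 then D r a else 0)"
    unfolding sum_distrib_left [symmetric] bernoulli_convolution by (intro sum.cong) auto
  also have "\<dots> = D 1 a"
    using \<open>K \<ge> 1\<close> by simp
  finally have "\<bar>(\<Sum>k\<le>K. bernoulli k * (D k (a + 1) / fact k)) - (\<Sum>k\<le>K. bernoulli k * (D k a / fact k)) - D 1 a\<bar>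
      = \<bar>\<Sum>k\<le>K. bernoulli k / fact k * R k\<bar>"
    by simp
  also have "\<dots> \<le> (\<Sum>k\<le>K. \<bar>bernoulli k / fact k * R k\<bar>)"
    by (rule sum_abs)
  also have "\<dots> \<le> (\<Sum>k\<le>K. \<bar>bernoulli k\<bar> * B)"
  proof (intro sum_mono)
    fix k assume "k \<in> {..K}"
    have "\<bar>bernoulli k\<bar> / fact k \<le> \<bar>bernoulli k\<bar> / 1"
      by (intro divide_left_mono fact_ge_1) auto
    then have "\<bar>bernoulli k\<bar> / fact k * \<bar>R k\<bar> \<le> \<bar>bernoulli k\<bar> * B"
      using R [of k] \<open>k \<in> {..K}\<close> by (intro mult_mono) auto
    then show "\<bar>bernoulli k / fact k * R k\<bar> \<le> \<bar>bernoulli k\<bar> * B"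
      by (simp add: abs_mult)
  qed
  finally show ?thesis
    by (simp add: sum_distrib_right)
qed

text \<open>The increments of the Bernoulli combination telescope to minus its value at
  \<open>N\<close>, since every \<open>D k\<close> vanishes at infinity. The bound
  \<open>B n\<close> varies with the interval so that the step errors can be summed.\<close>

lemma euler_maclaurin_tail:
  fixes D :: "nat \<Rightarrow> real \<Rightarrow> real" and B :: "nat \<Rightarrow> real"
  assumes deriv: "\<And>k t. k \<le> K \<Longrightarrow> real N \<le> t \<Longrightarrow> (D k has_real_derivative D (Suc k) t) (at t)"
    and lim: "\<And>k. k \<le> K \<Longrightarrow> (D k \<longlongrightarrow> 0) at_top"
    and bound: "\<And>n t. real (n + N) \<le> t \<Longrightarrow> \<bar>D (Suc K) t\<bar> \<le> B n"
    and "summable B" and "summable (\<lambda>n. D 1 (real (n + N)))" and "K \<ge> 1"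
  shows "\<bar>(\<Sum>n. D 1 (real (n + N))) + (\<Sum>k\<le>K. bernoulli k * (D k (real N) / fact k))\<bar>
    \<le> (\<Sum>k\<le>K. \<bar>bernoulli k\<bar>) * (\<Sum>n. B n)"
proof -
  define T where "T t = (\<Sum>k\<le>K. bernoulli k * (D k t / fact k))" for t
  define c where "c = (\<Sum>k\<le>K. \<bar>bernoulli k\<bar>)"
  \<comment> \<open>The local error of replacing a summand by an increment of
    \<open>T\<close>.\<close>
  define \<rho> where "\<rho> n = T (real (Suc n + N)) - T (real (n + N)) - D 1 (real (n + N))" for n
  have \<rho>: "\<bar>\<rho> n\<bar> \<le> c * B n" for n
    using euler_maclaurin_step [of K "real (n + N)" D "B n"] deriv bound [of n] \<open>K \<ge> 1\<close>
    unfolding \<rho>_def T_def c_def by (simp add: add_ac)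
  have "(T \<longlongrightarrow> (\<Sum>k\<le>K. bernoulli k * (0 / fact k))) at_top"
    unfolding T_def by (intro tendsto_intros lim) auto
  then have "(T \<longlongrightarrow> 0) at_top" by simp
  then have "(\<lambda>n. T (real (n + N))) \<longlonglongrightarrow> 0"
    by (rule filterlim_compose)
      (intro filterlim_compose [OF filterlim_real_sequentially] filterlim_add_const_nat_at_top)
  from telescope_sums [OF this]
  have tele: "(\<lambda>n. T (real (Suc n + N)) - T (real (n + N))) sums (0 - T (real N))"
    by simp
  then have "\<rho> sums (0 - T (real N) - (\<Sum>n. D 1 (real (n + N))))"
    unfolding \<rho>_def by (rule sums_diff [OF _ summable_sums]) fact
  then have "(\<Sum>n. D 1 (real (n + N))) + T (real N) = - (\<Sum>n. \<rho> n)"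
    by (simp add: sums_iff)
  moreover have sB: "summable (\<lambda>n. c * B n)"
    using \<open>summable B\<close> by (rule summable_mult)
  moreover have s\<rho>: "summable (\<lambda>n. \<bar>\<rho> n\<bar>)"
    by (rule summable_comparison_test' [OF sB]) (use \<rho> in auto)
  moreover have "\<bar>\<Sum>n. \<rho> n\<bar> \<le> (\<Sum>n. \<bar>\<rho> n\<bar>)"
    using summable_rabs [OF s\<rho>] .
  moreover have "(\<Sum>n. \<bar>\<rho> n\<bar>) \<le> (\<Sum>n. c * B n)"
    by (rule suminf_le [OF \<rho> s\<rho> sB])
  moreover have "(\<Sum>n. c * B n) = c * (\<Sum>n. B n)"
    using \<open>summable B\<close> by (rule suminf_mult)
  ultimately show ?thesis
    unfolding T_def c_def by simp
qed

section \<open>Shape, size and decay of the derivatives of \<open>G\<close>\<close>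

text \<open>In v = 1/u, differentiation by u is -v^2 d/dv, which preserves this shape and raises the
  degrees by at most 2. The form starts at the first derivative because \<open>G\<close> itself, v
  sin v, lacks the full factor v^2; that factor later makes the remainders summable.\<close>

lemma higher_deriv_G_form:
  "\<exists>p q :: real poly. degree p \<le> 2 * k + 1 \<and> degree q \<le> 2 * k + 1 \<and>
    (\<forall>u>0. ((deriv ^^ k) G has_real_derivative
        (1 / u)\<^sup>2 * (poly p (1 / u) * sin (1 / u) + poly q (1 / u) * cos (1 / u))) (at u))"
proof (induction k)
  case 0
  have "(G has_real_derivative
      (1 / u)\<^sup>2 * (poly [:-1:] (1 / u) * sin (1 / u) + poly [:0, -1:] (1 / u) * cos (1 / u))) (at u)"
    if "u > 0" for u
    unfolding G_def [abs_def]
    by (rule derivative_eq_intros refl | use that in \<open>simp; fail\<close>)+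
      (use that in \<open>simp add: field_simps power2_eq_square\<close>)
  then show ?case
    by (intro exI [of _ "[:-1:]"] exI [of _ "[:0, -1:]"]) simp
next
  case (Suc k)
  then obtain p q :: "real poly" where deg: "degree p \<le> 2 * k + 1" "degree q \<le> 2 * k + 1"
    and D: "\<And>u. u > 0 \<Longrightarrow> ((deriv ^^ k) G has_real_derivative
        (1 / u)\<^sup>2 * (poly p (1 / u) * sin (1 / u) + poly q (1 / u) * cos (1 / u))) (at u)"
    by blast
  define X where "X = [:0, 1 :: real:]"
  \<comment> \<open>Coefficients of sin v and cos v in -d/dv (v^2 (p sin v + q cos v)); the v^2 of
    the chain rule stays outside as the common factor.\<close>
  define p' where "p' = - (X * (2 * p + X * (pderiv p - q)))"
  define q' where "q' = - (X * (2 * q + X * (pderiv q + p)))"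
  have X: "degree (X * r) \<le> Suc (degree r)" for r
    using degree_mult_le [of X r] by (simp add: X_def)
  have two: "degree (2 * r) \<le> degree r" for r :: "real poly"
    using degree_mult_le [of 2 r] by simp
  have aux: "degree (- (X * (2 * r + X * s))) \<le> 2 * Suc k + 1"
    if "degree r \<le> 2 * k + 1" "degree s \<le> 2 * k + 1" for r s
  proof -
    have "degree (2 * r + X * s) \<le> 2 * k + 2"
      using that X [of s] two [of r] by (intro degree_add_le) auto
    with X [of "2 * r + X * s"] show ?thesis by simp
  qed
  have deg': "degree p' \<le> 2 * Suc k + 1" "degree q' \<le> 2 * Suc k + 1"
    unfolding p'_def q'_def using deg degree_pderiv [of p] degree_pderiv [of q]
    by (intro aux degree_diff_le degree_add_le; simp)+
  have "((deriv ^^ Suc k) G has_real_derivative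
      (1 / u)\<^sup>2 * (poly p' (1 / u) * sin (1 / u) + poly q' (1 / u) * cos (1 / u))) (at u)"
    if "u > 0" for u
  \<comment> \<open>The induction hypothesis identifies the iterated derivative with the formula
    only for positive arguments, which form an open set.\<close>
  proof (rule has_field_derivative_transform_within_open [where S = "{0<..}"])
    show "((\<lambda>u. (1 / u)\<^sup>2 * (poly p (1 / u) * sin (1 / u) + poly q (1 / u) * cos (1 / u)))
        has_real_derivative
        (1 / u)\<^sup>2 * (poly p' (1 / u) * sin (1 / u) + poly q' (1 / u) * cos (1 / u))) (at u)"
      by (rule derivative_eq_intros DERIV_chain2 [OF poly_DERIV] refl | use that in \<open>simp; fail\<close>)+
        (use that in \<open>simp add: p'_def q'_def X_def field_simps power2_eq_square\<close>)
  qed (use that DERIV_imp_deriv [OF D] in auto)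
  with deg' show ?case by blast
qed

lemma has_derivative_higher_deriv_G:
  assumes "u > 0"
  shows "((deriv ^^ k) G has_real_derivative (deriv ^^ Suc k) G u) (at u)"
proof -
  obtain d where d: "((deriv ^^ k) G has_real_derivative d) (at u)"
    using higher_deriv_G_form [of k] assms by blast
  then show ?thesis
    using DERIV_imp_deriv [OF d] by simp
qed

lemma abs_poly_le_power:
  fixes p :: "real poly"
  assumes "degree p \<le> d" "0 \<le> v" "v \<le> w" "1 \<le> w"
  shows "\<bar>poly p v\<bar> \<le> (\<Sum>i\<le>degree p. \<bar>coeff p i\<bar>) * w ^ d"
proof -
  have "\<bar>poly p v\<bar> \<le> (\<Sum>i\<le>degree p. \<bar>coeff p i * v ^ i\<bar>)"
    unfolding poly_altdef by (rule sum_abs)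
  also have "\<dots> \<le> (\<Sum>i\<le>degree p. \<bar>coeff p i\<bar> * w ^ d)"
  proof (intro sum_mono)
    fix i assume "i \<in> {..degree p}"
    then have "v ^ i \<le> w ^ i" "w ^ i \<le> w ^ d"
      using assms by (auto intro: power_mono power_increasing)
    then show "\<bar>coeff p i * v ^ i\<bar> \<le> \<bar>coeff p i\<bar> * w ^ d"
      using assms by (auto simp: abs_mult intro!: mult_left_mono)
  qed
  finally show ?thesis by (simp add: sum_distrib_right)
qed

text \<open>The bound \<open>w\<close> is kept apart from \<open>1 / u\<close> so that it can stay
  fixed while \<open>u\<close> runs through a tail and \<open>(1 / u)\<^sup>2\<close> still decays.
  As \<open>w \<ge> 1\<close>, the lower powers are absorbed into the top one.\<close>

lemma higher_deriv_G_bound: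
  "\<exists>C>0. \<forall>u w. 0 < u \<and> 1 / u \<le> w \<and> 1 \<le> w \<longrightarrow>
    \<bar>(deriv ^^ Suc k) G u\<bar> \<le> C * (1 / u)\<^sup>2 * w ^ (2 * k + 1)"
proof -
  obtain p q :: "real poly" where deg: "degree p \<le> 2 * k + 1" "degree q \<le> 2 * k + 1"
    and D: "\<And>u. u > 0 \<Longrightarrow> ((deriv ^^ k) G has_real_derivative
        (1 / u)\<^sup>2 * (poly p (1 / u) * sin (1 / u) + poly q (1 / u) * cos (1 / u))) (at u)"
    using higher_deriv_G_form [of k] by blast
  define C where "C = 1 + (\<Sum>i\<le>degree p. \<bar>coeff p i\<bar>) + (\<Sum>i\<le>degree q. \<bar>coeff q i\<bar>)"
  have "\<bar>(deriv ^^ Suc k) G u\<bar> \<le> C * (1 / u)\<^sup>2 * w ^ (2 * k + 1)"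
    if "0 < u" "1 / u \<le> w" "1 \<le> w" for u w
  proof -
    have P: "\<bar>poly p (1 / u)\<bar> \<le> (\<Sum>i\<le>degree p. \<bar>coeff p i\<bar>) * w ^ (2 * k + 1)"
      and Q: "\<bar>poly q (1 / u)\<bar> \<le> (\<Sum>i\<le>degree q. \<bar>coeff q i\<bar>) * w ^ (2 * k + 1)"
      using deg that by (auto intro!: abs_poly_le_power simp del: power_Suc)
    have "\<bar>poly p (1 / u) * sin (1 / u) + poly q (1 / u) * cos (1 / u)\<bar>
        \<le> \<bar>poly p (1 / u)\<bar> * \<bar>sin (1 / u)\<bar> + \<bar>poly q (1 / u)\<bar> * \<bar>cos (1 / u)\<bar>"
      by (metis abs_mult abs_triangle_ineq)
    also have "\<dots> \<le> \<bar>poly p (1 / u)\<bar> * 1 + \<bar>poly q (1 / u)\<bar> * 1"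
      by (intro add_mono mult_left_mono) auto
    also have "\<dots> \<le> C * w ^ (2 * k + 1)"
      using P Q zero_le_power [of w "2 * k + 1"] that unfolding C_def distrib_right by linarith
    finally have "(1 / u)\<^sup>2 * \<bar>poly p (1 / u) * sin (1 / u) + poly q (1 / u) * cos (1 / u)\<bar>
        \<le> (1 / u)\<^sup>2 * (C * w ^ (2 * k + 1))"
      by (rule mult_left_mono) simp
    moreover have "(deriv ^^ Suc k) G u
        = (1 / u)\<^sup>2 * (poly p (1 / u) * sin (1 / u) + poly q (1 / u) * cos (1 / u))"
      using DERIV_imp_deriv [OF D] that by simp
    ultimately show ?thesis
      by (simp only: abs_mult abs_power2 mult_ac)
  qed
  moreover have "C > 0"
    unfolding C_def by (intro add_pos_nonneg sum_nonneg) auto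
  ultimately show ?thesis by blast
qed

lemma higher_deriv_G_tendsto_0: "((deriv ^^ k) G \<longlongrightarrow> 0) at_top"
\<comment> \<open>The general bound begins at the first derivative, so \<open>G\<close> itself is
  treated directly.\<close>
proof (cases k)
  case 0
  have "((\<lambda>u::real. 1 / u * sin (1 / u)) \<longlongrightarrow> 0) at_top"
  proof (rule Lim_null_comparison)
    show "\<forall>\<^sub>F u :: real in at_top. norm (1 / u * sin (1 / u)) \<le> 1 / u"
      using eventually_gt_at_top [of 0]
      by eventually_elim (auto simp: abs_mult divide_le_cancel)
    show "((\<lambda>u::real. 1 / u) \<longlongrightarrow> 0) at_top"
      by real_asymp
  qed
  with 0 show ?thesis by (simp add: G_def [abs_def])
next
  case (Suc j)
  obtain C where C: "\<And>u w. 0 < u \<Longrightarrow> 1 / u \<le> w \<Longrightarrow> 1 \<le> w \<Longrightarrow>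
      \<bar>(deriv ^^ Suc j) G u\<bar> \<le> C * (1 / u)\<^sup>2 * w ^ (2 * j + 1)"
    using higher_deriv_G_bound [of j] by blast
  show ?thesis
    unfolding Suc
  proof (rule Lim_null_comparison)
    show "\<forall>\<^sub>F u in at_top. norm ((deriv ^^ Suc j) G u) \<le> C * (1 / u)\<^sup>2"
      using eventually_ge_at_top [of 1]
    proof eventually_elim
      case (elim u)
      then show ?case using C [of u 1] by simp
    qed
    show "((\<lambda>u::real. C * (1 / u)\<^sup>2) \<longlongrightarrow> 0) at_top"
      by real_asymp
  qed
qed

section \<open>Expansion of the error term for arbitrary \<open>N\<close>\<close>

text \<open>Euler-Maclaurin with \<open>K = 2 * L\<close>: the terms \<open>k = 0\<close> and
  \<open>k = 1\<close> are minus the sine integral and minus half the summand at \<open>N\<close>,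
  exactly what \<open>Q_error\<close> splits off, so only the even Bernoulli terms remain.\<close>

lemma Q_error_expansion:
  assumes "L > 0" "N > 0" "x > 0"
    and bound: "\<And>n t. real (n + N) \<le> t \<Longrightarrow> \<bar>(deriv ^^ (2 * L)) G (t / x) / x ^ Suc (2 * L)\<bar> \<le> B n"
    and "summable B"
  shows "\<bar>Q_error N x + (\<Sum>m=1..L. bernoulli (2 * m) / fact (2 * m)
        * ((deriv ^^ (2 * m - 1)) G (real N / x) / x ^ (2 * m)))\<bar>
    \<le> (\<Sum>k\<le>2 * L. \<bar>bernoulli k\<bar>) * (\<Sum>n. B n)"
proof -
  \<comment> \<open>The summand is \<open>G (t / x) / x\<close>, so each differentiation costs a
    factor \<open>1 / x\<close>; the index of \<open>D\<close> is one ahead of the order of the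
    derivative of \<open>G\<close> because \<open>D 0\<close> is the antiderivative.\<close>
  define D where "D k t = (case k of 0 \<Rightarrow> - Si (x / t)
    | Suc j \<Rightarrow> (deriv ^^ j) G (t / x) / x ^ Suc j)" for k and t :: real
  define f where "f n = 1 / real n * sin (x / real n)" for n
  have D1: "D 1 t = 1 / t * sin (x / t)" for t
    using \<open>x > 0\<close> by (simp add: D_def G_def)
  have deriv: "(D k has_real_derivative D (Suc k) t) (at t)" if "t > 0" for k t
  proof (cases k)
    case 0
    have "((\<lambda>t. - Si (x / t)) has_real_derivative - (sinc (x / t) * (- x / t\<^sup>2))) (at t)"
      by (rule derivative_eq_intros DERIV_chain2 [OF DERIV_Si] refl | use that in \<open>simp; fail\<close>)+
        (use that in \<open>simp add: power2_eq_square\<close>)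
    moreover have "- (sinc (x / t) * (- x / t\<^sup>2)) = D (Suc k) t"
      using that \<open>x > 0\<close> D1 [of t] 0 by (simp add: power2_eq_square)
    ultimately show ?thesis
      using 0 by (simp add: D_def [abs_def])
  next
    case (Suc j)
    have "((\<lambda>t. (deriv ^^ j) G (t / x) / x ^ Suc j) has_real_derivative
        (deriv ^^ Suc j) G (t / x) * (1 / x) / x ^ Suc j) (at t)"
      by (intro DERIV_cdivide DERIV_chain2 [OF has_derivative_higher_deriv_G] DERIV_ident)
        (use that \<open>x > 0\<close> in auto)
    then show ?thesis
      using Suc by (simp add: D_def [abs_def])
  qed
  have lim: "(D k \<longlongrightarrow> 0) at_top" for k
  proof (cases k)
    case 0
    have "((\<lambda>t. x / t) \<longlongrightarrow> 0) at_top"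
      by real_asymp
    then have "((\<lambda>t. - Si (x / t)) \<longlongrightarrow> - Si 0) at_top"
      by (intro tendsto_minus isCont_tendsto_compose [OF isCont_Si])
    moreover have "Si 0 = 0"
      by (simp add: Si_def zero_ereal_def [symmetric])
    ultimately show ?thesis
      using 0 by (simp add: D_def [abs_def])
  next
    case (Suc j)
    have "filterlim (\<lambda>t. t / x) at_top at_top"
      using \<open>x > 0\<close> by real_asymp
    then have "((\<lambda>t. (deriv ^^ j) G (t / x) / x ^ Suc j) \<longlongrightarrow> 0 / x ^ Suc j) at_top"
      by (intro tendsto_divide tendsto_const filterlim_compose [OF higher_deriv_G_tendsto_0])
        (use \<open>x > 0\<close> in auto)
    then show ?thesis
      using Suc by (simp add: D_def [abs_def])
  qed
  have f: "D 1 (real n) = f n" for n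
    unfolding D1 f_def ..
  have sf: "summable (\<lambda>n. f (Suc n))"
    unfolding f_def by (rule summable_hardy_littlewood_Q)
  then have sfN: "summable (\<lambda>n. f (n + N))"
    by (simp add: summable_Suc_iff summable_iff_shift)
  have Q: "hardy_littlewood_Q x = (\<Sum>n. f (n + N)) + (\<Sum>n=1..N - 1. f n)"
  proof -
    have "hardy_littlewood_Q x = (\<Sum>n. f (Suc n))"
      by (simp add: hardy_littlewood_Q_def f_def)
    \<comment> \<open>The series starts at \<open>f 1\<close>, so the summand \<open>f N\<close> has
      index \<open>N - 1\<close>.\<close>
    also have "\<dots> = (\<Sum>n. f (Suc (n + (N - 1)))) + (\<Sum>n<N - 1. f (Suc n))"
      by (rule suminf_split_initial_segment [OF sf])
    also have "(\<Sum>n<N - 1. f (Suc n)) = (\<Sum>n=1..N - 1. f n)"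
      by (rule sum.reindex_bij_witness [of _ "\<lambda>n. n - 1" Suc]) auto
    finally show ?thesis
      using \<open>N > 0\<close> by simp
  qed
  have "\<bar>D (Suc (2 * L)) t\<bar> \<le> B n" if "real (n + N) \<le> t" for n t
    using bound [OF that] by (simp add: D_def)
  moreover have "summable (\<lambda>n. D 1 (real (n + N)))"
    unfolding f by (rule sfN)
  ultimately have "\<bar>(\<Sum>n. D 1 (real (n + N))) + (\<Sum>k\<le>2 * L. bernoulli k * (D k (real N) / fact k))\<bar>
      \<le> (\<Sum>k\<le>2 * L. \<bar>bernoulli k\<bar>) * (\<Sum>n. B n)"
    using assms by (intro euler_maclaurin_tail deriv lim) auto
  also have "(\<Sum>k\<le>2 * L. bernoulli k * (D k (real N) / fact k))
      = - Si (x / real N) - f N / 2 + (\<Sum>m=1..L. bernoulli (2 * m) * (D (2 * m) (real N) / fact (2 * m)))"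
    by (subst sum_bernoulli_even [OF \<open>L > 0\<close>]) (simp add: f del: One_nat_def, simp add: D_def)
  also have "(\<Sum>m=1..L. bernoulli (2 * m) * (D (2 * m) (real N) / fact (2 * m)))
      = (\<Sum>m=1..L. bernoulli (2 * m) / fact (2 * m)
        * ((deriv ^^ (2 * m - 1)) G (real N / x) / x ^ (2 * m)))"
    by (intro sum.cong refl) (auto simp: D_def split: nat.split simp del: power_Suc fact_Suc)
  finally show ?thesis
    unfolding f Q_error_def Q by (simp add: f_def algebra_simps)
qed

section \<open>Powers of \<open>x\<close> at the cutoff\<close>

text \<open>For \<open>y = x powr (1 / 2 + \<epsilon>)\<close> one has
  \<open>1 \<le> y \<le> x\<close>, and rounding down a number that is at least 1 loses at most a
  factor 2. The lower bound 1 on the ratio makes it an admissible \<open>w\<close> in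
  \<open>higher_deriv_G_bound\<close>.\<close>

lemma cutoff_bounds:
  assumes "0 < \<epsilon>" "\<epsilon> < 1 / 2" "x \<ge> 1"
  shows "cutoff \<epsilon> x > 0" "1 \<le> x / real (cutoff \<epsilon> x)"
    "x / real (cutoff \<epsilon> x) \<le> 2 * x powr (1 / 2 - \<epsilon>)"
proof -
  define y where "y = x powr (1 / 2 + \<epsilon>)"
  have "1 \<le> y"
    unfolding y_def using assms by (intro ge_one_powr_ge_zero) auto
  have "y \<le> x powr 1"
    unfolding y_def using assms by (intro powr_mono) auto
  then have "y \<le> x"
    using assms by simp
  have N: "real (cutoff \<epsilon> x) = of_int \<lfloor>y\<rfloor>"
    using \<open>1 \<le> y\<close> by (simp add: cutoff_def y_def)
  have "1 \<le> \<lfloor>y\<rfloor>"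
    using \<open>1 \<le> y\<close> by simp
  then have "1 \<le> real_of_int \<lfloor>y\<rfloor>" "y \<le> 2 * real_of_int \<lfloor>y\<rfloor>"
    by linarith+
  then have le: "1 \<le> real (cutoff \<epsilon> x)" "real (cutoff \<epsilon> x) \<le> y" "y \<le> 2 * real (cutoff \<epsilon> x)"
    unfolding N by (simp_all only: of_int_floor_le)
  then show "cutoff \<epsilon> x > 0" "1 \<le> x / real (cutoff \<epsilon> x)"
    using \<open>y \<le> x\<close> by (auto simp: field_simps)
  have "x / real (cutoff \<epsilon> x) \<le> x / (y / 2)"
    using le assms \<open>1 \<le> y\<close> by (intro divide_left_mono) auto
  also have "\<dots> = 2 * (x powr 1 / x powr (1 / 2 + \<epsilon>))"
    using assms by (simp add: y_def)
  also have "\<dots> = 2 * x powr (1 / 2 - \<epsilon>)"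
    unfolding powr_diff [symmetric] by simp
  finally show "x / real (cutoff \<epsilon> x) \<le> 2 * x powr (1 / 2 - \<epsilon>)" .
qed

lemma cutoff_ratio_power_le:
  assumes "0 < \<epsilon>" "\<epsilon> < 1 / 2" "x \<ge> 1"
  shows "(x / real (cutoff \<epsilon> x)) ^ k \<le> 2 ^ k * x powr ((1 / 2 - \<epsilon>) * real k)"
proof -
  have "(x / real (cutoff \<epsilon> x)) ^ k \<le> (2 * x powr (1 / 2 - \<epsilon>)) ^ k"
    using cutoff_bounds [OF assms] assms by (intro power_mono) auto
  then show ?thesis
    using assms by (simp add: power_mult_distrib powr_power mult.commute)
qed

text \<open>With \<open>v = x / N\<close> the derivative has order v^(4m-1), and (1/2 -
  \<epsilon>)(4m - 1) - 2m = -1/2 - (4m - 1)\<epsilon>. At m = M + 1 this is the exponent of the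
  theorem: the first discarded term dictates the error.\<close>

lemma bernoulli_term_bound:
  fixes \<epsilon> :: real
  assumes "0 < \<epsilon>" "\<epsilon> < 1 / 2" "m > 0"
  shows "\<exists>C>0. \<forall>x\<ge>1. \<bar>(deriv ^^ (2 * m - 1)) G (real (cutoff \<epsilon> x) / x) / x ^ (2 * m)\<bar>
    \<le> C * x powr (- 1 / 2 - (4 * real m - 1) * \<epsilon>)"
proof -
  define k where "k = 2 * m - 2"
  have k: "2 * m - 1 = Suc k" "2 + (2 * k + 1) = 4 * m - 1" "4 * m \<ge> 1"
    using \<open>m > 0\<close> by (auto simp: k_def)
  obtain C where "C > 0" and C: "\<And>u w. 0 < u \<Longrightarrow> 1 / u \<le> w \<Longrightarrow> 1 \<le> w \<Longrightarrow>
      \<bar>(deriv ^^ Suc k) G u\<bar> \<le> C * (1 / u)\<^sup>2 * w ^ (2 * k + 1)"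
    using higher_deriv_G_bound [of k] by blast
  have "\<bar>(deriv ^^ (2 * m - 1)) G (real (cutoff \<epsilon> x) / x) / x ^ (2 * m)\<bar>
      \<le> C * 2 ^ (4 * m - 1) * x powr (- 1 / 2 - (4 * real m - 1) * \<epsilon>)" if "x \<ge> 1" for x
  proof -
    define v where "v = x / real (cutoff \<epsilon> x)"
    note v = cutoff_bounds [OF assms(1,2) that, folded v_def]
    have "\<bar>(deriv ^^ Suc k) G (real (cutoff \<epsilon> x) / x)\<bar> \<le> C * v\<^sup>2 * v ^ (2 * k + 1)"
      using C [of "real (cutoff \<epsilon> x) / x" v] v that by (simp add: v_def)
    also have "\<dots> = C * v ^ (4 * m - 1)"
      by (simp only: mult.assoc power_add [symmetric] k)
    also have "\<dots> \<le> C * (2 ^ (4 * m - 1) * x powr ((1 / 2 - \<epsilon>) * real (4 * m - 1)))"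
      using \<open>C > 0\<close> cutoff_ratio_power_le [OF assms(1,2) that] unfolding v_def
      by (intro mult_left_mono) auto
    finally have "\<bar>(deriv ^^ Suc k) G (real (cutoff \<epsilon> x) / x)\<bar> / x ^ (2 * m)
        \<le> C * (2 ^ (4 * m - 1) * x powr ((1 / 2 - \<epsilon>) * real (4 * m - 1))) / x ^ (2 * m)"
      using that by (intro divide_right_mono) auto
    also have "\<dots> = C * 2 ^ (4 * m - 1) * (x powr ((1 / 2 - \<epsilon>) * real (4 * m - 1)) / x powr real (2 * m))"
      using that by (subst powr_realpow) auto
    also have "\<dots> = C * 2 ^ (4 * m - 1) * x powr ((1 / 2 - \<epsilon>) * real (4 * m - 1) - real (2 * m))"
      by (simp only: powr_diff)
    also have "(1 / 2 - \<epsilon>) * real (4 * m - 1) - real (2 * m) = - 1 / 2 - (4 * real m - 1) * \<epsilon>"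
      using k(3) by (simp add: of_nat_diff field_simps)
    finally show ?thesis
      using that unfolding k(1) abs_divide by simp
  qed
  then show ?thesis
    using \<open>C > 0\<close> by (intro exI [of _ "C * 2 ^ (4 * m - 1)"]) auto
qed

text \<open>
  The remainder is estimated crudely, losing a factor of order \<open>x\<close>; this is harmless because
  \<open>L\<close> may be taken as large as desired.
\<close>
lemma Q_error_expansion_cutoff:
  fixes \<epsilon> :: real
  assumes "0 < \<epsilon>" "\<epsilon> < 1 / 2" "L > 0"
  shows "\<exists>C>0. \<forall>x\<ge>1. \<bar>Q_error (cutoff \<epsilon> x) x + (\<Sum>m=1..L. bernoulli (2 * m) / fact (2 * m)
        * ((deriv ^^ (2 * m - 1)) G (real (cutoff \<epsilon> x) / x) / x ^ (2 * m)))\<bar>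
    \<le> C * x powr (1 - 4 * real L * \<epsilon>)"
proof -
  define k where "k = 2 * L - 1"
  have k: "2 * L = Suc k" "2 * k + 1 \<le> 4 * L"
    using \<open>L > 0\<close> by (auto simp: k_def)
  obtain C where "C > 0" and C: "\<And>u w. 0 < u \<Longrightarrow> 1 / u \<le> w \<Longrightarrow> 1 \<le> w \<Longrightarrow>
      \<bar>(deriv ^^ Suc k) G u\<bar> \<le> C * (1 / u)\<^sup>2 * w ^ (2 * k + 1)"
    using higher_deriv_G_bound [of k] by blast
  have "summable (\<lambda>n. 1 / real n ^ 2)"
    using inverse_power_summable [of 2, where 'a = real] by (simp add: field_simps)
  then have sq: "summable (\<lambda>n. 1 / real (Suc n) ^ 2)"
    by (subst summable_Suc_iff)
  define S where "S = (\<Sum>n. 1 / real (Suc n) ^ 2)"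
  define c where "c = (\<Sum>k\<le>2 * L. \<bar>bernoulli k\<bar>)"
  have "S \<ge> 0"
    unfolding S_def by (rule suminf_nonneg [OF sq]) simp
  have "c \<ge> 0"
    unfolding c_def by (rule sum_nonneg) simp
  have "\<bar>Q_error (cutoff \<epsilon> x) x + (\<Sum>m=1..L. bernoulli (2 * m) / fact (2 * m)
        * ((deriv ^^ (2 * m - 1)) G (real (cutoff \<epsilon> x) / x) / x ^ (2 * m)))\<bar>
      \<le> (c * (C * 2 ^ (4 * L) * S) + 1) * x powr (1 - 4 * real L * \<epsilon>)" if "x \<ge> 1" for x
  proof -
    define N where "N = cutoff \<epsilon> x"
    define v where "v = x / real N"
    note v = cutoff_bounds [OF assms(1,2) that, folded N_def, folded v_def]
    define A where "A = C * 2 ^ (4 * L) * x powr (1 - 4 * real L * \<epsilon>)"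
    have v_le: "v ^ (2 * k + 1) \<le> 2 ^ (4 * L) * x powr (2 * real L - 4 * real L * \<epsilon>)"
    proof -
      \<comment> \<open>The exponent is really \<open>4 * L - 1\<close>; rounding it up is allowed
        because \<open>v \<ge> 1\<close>.\<close>
      have "v ^ (2 * k + 1) \<le> v ^ (4 * L)"
        using v k by (intro power_increasing) auto
      also have "\<dots> \<le> 2 ^ (4 * L) * x powr ((1 / 2 - \<epsilon>) * real (4 * L))"
        unfolding v_def N_def by (rule cutoff_ratio_power_le [OF assms(1,2) that])
      finally show ?thesis
        by (simp add: algebra_simps)
    qed
    have bound: "\<bar>(deriv ^^ (2 * L)) G (t / x) / x ^ Suc (2 * L)\<bar> \<le> A * (1 / real (Suc n) ^ 2)"
      if t: "real (n + N) \<le> t" for n t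
    proof -
      \<comment> \<open>The two lower bounds for \<open>t\<close> have separate uses:
        \<open>N\<close> bounds the polynomial factor by a power of \<open>v\<close>, and
        \<open>Suc n\<close> turns the factor \<open>(x / t)\<^sup>2\<close> into a summable one.
        The second holds since \<open>N \<ge> 1\<close>.\<close>
      have "real N \<le> t" "real (Suc n) \<le> t" "t > 0"
        using t v(1) by auto
      have "x / t \<le> v"
        unfolding v_def using \<open>real N \<le> t\<close> \<open>x \<ge> 1\<close> v(1) by (intro divide_left_mono) auto
      have "\<bar>(deriv ^^ (2 * L)) G (t / x)\<bar> \<le> C * (x / t)\<^sup>2 * v ^ (2 * k + 1)"
        using C [of "t / x" v] \<open>x / t \<le> v\<close> v \<open>t > 0\<close> \<open>x \<ge> 1\<close> by (simp add: k)
      also have "\<dots> \<le> C * (x / real (Suc n))\<^sup>2 * (2 ^ (4 * L) * x powr (2 * real L - 4 * real L * \<epsilon>))"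
        using \<open>C > 0\<close> \<open>x \<ge> 1\<close> \<open>t > 0\<close> v \<open>real (Suc n) \<le> t\<close>
        by (intro mult_mono v_le power_mono divide_left_mono mult_left_mono) auto
      finally have "\<bar>(deriv ^^ (2 * L)) G (t / x)\<bar> / x ^ Suc (2 * L)
          \<le> C * (x / real (Suc n))\<^sup>2 * (2 ^ (4 * L) * x powr (2 * real L - 4 * real L * \<epsilon>)) / x ^ Suc (2 * L)"
        using \<open>x \<ge> 1\<close> by (intro divide_right_mono) auto
      also have "\<dots> = C * 2 ^ (4 * L) * (x ^ 2 * x powr (2 * real L - 4 * real L * \<epsilon>) / x ^ Suc (2 * L))
          * (1 / real (Suc n) ^ 2)"
        by (simp add: power_divide mult_ac)
      also have "x ^ 2 * x powr (2 * real L - 4 * real L * \<epsilon>) / x ^ Suc (2 * L)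
          = x powr 2 * x powr (2 * real L - 4 * real L * \<epsilon>) / x powr real (Suc (2 * L))"
        using \<open>x \<ge> 1\<close> by (subst powr_realpow) auto
      also have "\<dots> = x powr (1 - 4 * real L * \<epsilon>)"
        unfolding powr_add [symmetric] powr_diff [symmetric] by (simp add: algebra_simps)
      finally show ?thesis
        using \<open>x \<ge> 1\<close> by (simp add: A_def)
    qed
    have "\<bar>Q_error N x + (\<Sum>m=1..L. bernoulli (2 * m) / fact (2 * m)
        * ((deriv ^^ (2 * m - 1)) G (real N / x) / x ^ (2 * m)))\<bar>
        \<le> c * (\<Sum>n. A * (1 / real (Suc n) ^ 2))"
      unfolding c_def using \<open>L > 0\<close> v(1) that
      by (intro Q_error_expansion bound summable_mult sq) auto
    also have "(\<Sum>n. A * (1 / real (Suc n) ^ 2)) = A * S"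
      unfolding S_def by (rule suminf_mult [OF sq])
    also have "c * (A * S) \<le> (c * (C * 2 ^ (4 * L) * S) + 1) * x powr (1 - 4 * real L * \<epsilon>)"
      by (simp add: A_def algebra_simps)
    finally show ?thesis
      by (simp only: N_def)
  qed
  moreover have "c * (C * 2 ^ (4 * L) * S) + 1 > 0"
    using \<open>C > 0\<close> \<open>S \<ge> 0\<close> \<open>c \<ge> 0\<close> by (intro add_nonneg_pos mult_nonneg_nonneg) auto
  ultimately show ?thesis by blast
qed

section \<open>Choice of the expansion length and removal of the surplus terms\<close>

theorem theorem1:
  fixes \<epsilon> :: real and M :: nat
  assumes "0 < \<epsilon>" and "\<epsilon> < 1 / 2"
  shows "\<exists>C>0. \<forall>x::real. x \<ge> 1 \<longrightarrow>
    (let N = cutoff \<epsilon> x in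
      \<bar>Q_error N x -
        (- (\<Sum>m = 1..M. bernoulli (2 * m) / fact (2 * m)
              * ((deriv ^^ (2 * m - 1)) G (real N / x) / x ^ (2 * m))))\<bar>
      \<le> C * x powr (- 1 / 2 - (4 * real M + 3) * \<epsilon>))"
proof -
  define e where "e = - 1 / 2 - (4 * real M + 3) * \<epsilon>"
  \<comment> \<open>Chosen so that the crude remainder exponent
    \<open>1 - 4 * real L * \<epsilon>\<close> is at most \<open>e\<close>; the \<open>Suc\<close>
    in \<open>L\<close> keeps \<open>L\<close> positive when \<open>M\<close> and \<open>L0\<close>
    are both 0.\<close>
  obtain L0 :: nat where L0: "(1 - e) / (4 * \<epsilon>) \<le> real L0"
    using real_arch_simple by blast
  define L where "L = Suc (max M L0)"
  have L: "L > 0" "M \<le> L" "L0 \<le> L"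
    by (auto simp: L_def)
  have "1 - e \<le> real L0 * (4 * \<epsilon>)"
    using L0 assms by (simp add: field_simps)
  also have "\<dots> \<le> real L * (4 * \<epsilon>)"
    using L assms by (intro mult_right_mono) auto
  finally have Le: "1 - 4 * real L * \<epsilon> \<le> e"
    by simp
  define \<tau> where "\<tau> m x = (deriv ^^ (2 * m - 1)) G (real (cutoff \<epsilon> x) / x) / x ^ (2 * m)" for m x
  define b where "b m = bernoulli (2 * m) / fact (2 * m)" for m
  obtain C0 where "C0 > 0" and C0: "\<And>x. x \<ge> 1 \<Longrightarrow>
      \<bar>Q_error (cutoff \<epsilon> x) x + (\<Sum>m=1..L. b m * \<tau> m x)\<bar> \<le> C0 * x powr (1 - 4 * real L * \<epsilon>)"
    using Q_error_expansion_cutoff [OF assms \<open>L > 0\<close>] unfolding \<tau>_def b_def by blast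
  have "\<forall>m\<in>{M<..L}. \<exists>C>0. \<forall>x\<ge>1. \<bar>\<tau> m x\<bar> \<le> C * x powr (- 1 / 2 - (4 * real m - 1) * \<epsilon>)"
    unfolding \<tau>_def using bernoulli_term_bound [OF assms] by auto
  then obtain C where Cpos: "\<And>m. m \<in> {M<..L} \<Longrightarrow> C m > 0"
    and C: "\<And>m x. m \<in> {M<..L} \<Longrightarrow> x \<ge> 1 \<Longrightarrow>
      \<bar>\<tau> m x\<bar> \<le> C m * x powr (- 1 / 2 - (4 * real m - 1) * \<epsilon>)"
    by metis
  define C1 where "C1 = C0 + (\<Sum>m\<in>{M<..L}. \<bar>b m\<bar> * C m)"
  have "C1 > 0"
    unfolding C1_def using \<open>C0 > 0\<close> Cpos
    by (intro add_pos_nonneg sum_nonneg mult_nonneg_nonneg) (auto intro: less_imp_le)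
  have "\<bar>Q_error (cutoff \<epsilon> x) x - (- (\<Sum>m=1..M. b m * \<tau> m x))\<bar> \<le> C1 * x powr e" if "x \<ge> 1" for x
  proof -
    have "{1..L} = {1..M} \<union> {M<..L}"
      using L by auto
    then have "(\<Sum>m=1..L. b m * \<tau> m x) = (\<Sum>m=1..M. b m * \<tau> m x) + (\<Sum>m\<in>{M<..L}. b m * \<tau> m x)"
      by (simp only:) (rule sum.union_disjoint, auto)
    then have "\<bar>Q_error (cutoff \<epsilon> x) x - (- (\<Sum>m=1..M. b m * \<tau> m x))\<bar>
        \<le> \<bar>Q_error (cutoff \<epsilon> x) x + (\<Sum>m=1..L. b m * \<tau> m x)\<bar> + \<bar>\<Sum>m\<in>{M<..L}. b m * \<tau> m x\<bar>"
      by linarith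
    also have "\<dots> \<le> C0 * x powr e + (\<Sum>m\<in>{M<..L}. \<bar>b m\<bar> * C m * x powr e)"
    proof (rule add_mono)
      have "C0 * x powr (1 - 4 * real L * \<epsilon>) \<le> C0 * x powr e"
        using \<open>C0 > 0\<close> that Le by (intro mult_left_mono powr_mono) auto
      with C0 [OF that] show "\<bar>Q_error (cutoff \<epsilon> x) x + (\<Sum>m=1..L. b m * \<tau> m x)\<bar> \<le> C0 * x powr e"
        by linarith
      have "\<bar>\<Sum>m\<in>{M<..L}. b m * \<tau> m x\<bar> \<le> (\<Sum>m\<in>{M<..L}. \<bar>b m * \<tau> m x\<bar>)"
        by (rule sum_abs)
      also have "\<dots> \<le> (\<Sum>m\<in>{M<..L}. \<bar>b m\<bar> * C m * x powr e)"
      proof (rule sum_mono)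
        fix m assume m: "m \<in> {M<..L}"
        \<comment> \<open>Hence 4m - 1 is at least 4M + 3, and as \<open>x \<ge> 1\<close> every
          surplus term is at most a multiple of \<open>x powr e\<close>.\<close>
        then have "real M + 1 \<le> real m" by auto
        then have "(4 * real M + 3) * \<epsilon> \<le> (4 * real m - 1) * \<epsilon>"
          using assms by (intro mult_right_mono) auto
        then have "C m * x powr (- 1 / 2 - (4 * real m - 1) * \<epsilon>) \<le> C m * x powr e"
          unfolding e_def using Cpos [OF m] that by (intro mult_left_mono powr_mono) auto
        with C [OF m that] have "\<bar>\<tau> m x\<bar> \<le> C m * x powr e"
          by linarith
        then show "\<bar>b m * \<tau> m x\<bar> \<le> \<bar>b m\<bar> * C m * x powr e"
          by (simp add: abs_mult mult.assoc mult_left_mono)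
      qed
      finally show "\<bar>\<Sum>m\<in>{M<..L}. b m * \<tau> m x\<bar> \<le> (\<Sum>m\<in>{M<..L}. \<bar>b m\<bar> * C m * x powr e)" .
    qed
    also have "\<dots> = C1 * x powr e"
      by (simp add: C1_def distrib_right sum_distrib_right)
    finally show ?thesis .
  qed
  then show ?thesis
    using \<open>C1 > 0\<close> unfolding \<tau>_def b_def e_def Let_def by blast
qed

end
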